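(* Let $a,b$ be positive real numbers with $b>a$, let $0<\alpha\le 1$, let $p>1$ and $q=\frac{p}{p-1}$. Then $$\left|12A(a^{\alpha+4},b^{\alpha+4}) - 12L_{\alpha+4}(a,b) - (b-a)^2(\alpha+3)(\alpha+4)L_{\alpha+2}(a,b)\right|$$ $$\le \frac{(b-a)^4}{2}\,\bigl(\beta(2p+1,2p+1)\bigr)^{\frac1p}(\alpha+1)(\alpha+2)(\alpha+3)(\alpha+4)\left(\max\{|a^{\alpha}|^q,|b^{\alpha}|^q\}\right)^{\frac1q}.$$
   Context: For positive numbers $x,y$, $A(x,y)=\frac{x+y}{2}$. For positive $a\ne b$ and real $r\ne -1,0$, $L_r(a,b)=\frac{b^{r+1}-a^{r+1}}{(r+1)(b-a)}$ (with no outer exponent $1/r$); only indices $r=\alpha+2$ and $r=\alpha+4$ are used. $\beta$ is the Euler Beta function, $\beta(s,t)=\int_0^1\lambda^{s-1}(1-\lambda)^{t-1}\,d\lambda$ for $s,t>0$. *)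

theory Defs
  imports "HOL-Analysis.Analysis"
begin

definition arith_mean :: "real \<Rightarrow> real \<Rightarrow> real" where
  "arith_mean x y = (x + y) / 2"

(* No outer exponent 1/r, unlike the usual generalized logarithmic mean.
   Meaningful for positive a \<noteq> b and r \<notin> {-1, 0}. *)
definition L_mean :: "real \<Rightarrow> real \<Rightarrow> real \<Rightarrow> real" where
  "L_mean r a b = (b powr (r + 1) - a powr (r + 1)) / ((r + 1) * (b - a))"

(* The library defines Beta via Gamma; on positive arguments it is Euler's integral. *)
lemma Beta_eq_integral:
  fixes s t :: real
  assumes "s > 0" "t > 0"
  shows "Beta s t = integral {0..1} (\<lambda>x. x powr (s - 1) * (1 - x) powr (t - 1))"
  using has_integral_Beta_real[OF assms] by (simp add: integral_unique)

end

theory Submission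
  imports Defs
begin

text \<open>With \<open>w t = t\<^sup>2 (1 - t)\<^sup>2\<close>, whose fourth derivative is \<open>24\<close>, four integrations by parts give
  \<open>\<integral> w h'''' = 2 (h' 1 - h' 0) - 12 (h 1 + h 0) + 24 \<integral> h\<close> on \<open>[0, 1]\<close>. For
  \<open>h t = (a + t (b - a))\<^bsup>\<alpha> + 4\<^esup>\<close> the right-hand side is \<open>-2\<close> times the quantity to be bounded. There
  \<open>h''''\<close> is nonnegative and increasing, and \<open>\<integral> w \<le> (\<integral> w\<^bsup>p\<^esup>)\<^bsup>1/p\<^esup>\<close> with
  \<open>\<integral> w\<^bsup>p\<^esup> = \<beta>(2p + 1, 2p + 1)\<close>.\<close>

lemma has_integral_quartic_weight:
  fixes G h h1 h2 h3 h4 :: "real \<Rightarrow> real"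
  assumes "\<And>t. t \<in> {0..1} \<Longrightarrow> (G has_real_derivative h t) (at t)"
    and "\<And>t. t \<in> {0..1} \<Longrightarrow> (h has_real_derivative h1 t) (at t)"
    and "\<And>t. t \<in> {0..1} \<Longrightarrow> (h1 has_real_derivative h2 t) (at t)"
    and "\<And>t. t \<in> {0..1} \<Longrightarrow> (h2 has_real_derivative h3 t) (at t)"
    and "\<And>t. t \<in> {0..1} \<Longrightarrow> (h3 has_real_derivative h4 t) (at t)"
  shows "((\<lambda>t. (t * (1 - t))^2 * h4 t) has_integral
           2 * (h1 1 - h1 0) - 12 * (h 1 + h 0) + 24 * (G 1 - G 0)) {0..1}"
proof -
  \<comment> \<open>\<open>P\<close> collects the integrated terms: the polynomial coefficients are
    \<open>w\<close>, \<open>w'\<close>, \<open>w''\<close>, \<open>w'''\<close> and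
    \<open>24\<close> with alternating signs, so its derivative telescopes to \<open>w * h4\<close>.
    At both endpoints \<open>w\<close> and \<open>w'\<close> vanish and \<open>w''\<close> is
    \<open>2\<close>, while \<open>w'''\<close> is \<open>-12\<close> at 0 and \<open>12\<close> at
    1.\<close>
  define P where "P = (\<lambda>t. (t^4 - 2 * t^3 + t^2) * h3 t - (4 * t^3 - 6 * t^2 + 2 * t) * h2 t
    + (12 * t^2 - 12 * t + 2) * h1 t - (24 * t - 12) * h t + 24 * G t)"
  have "(P has_real_derivative (t * (1 - t))^2 * h4 t) (at t)" if "t \<in> {0..1}" for t
    unfolding P_def
    by (auto intro!: derivative_eq_intros assms[OF that]
        simp: algebra_simps power2_eq_square power3_eq_cube power4_eq_xxxx)
  then have "((\<lambda>t. (t * (1 - t))^2 * h4 t) has_integral P 1 - P 0) {0..1}"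
    by (intro fundamental_theorem_of_calculus)
       (auto simp: has_real_derivative_iff_has_vector_derivative[symmetric]
             intro: has_field_derivative_at_within)
  moreover have "P 1 - P 0 = 2 * (h1 1 - h1 0) - 12 * (h 1 + h 0) + 24 * (G 1 - G 0)"
    by (simp add: P_def algebra_simps)
  ultimately show ?thesis
    by simp
qed

lemma has_integral_quartic_weight_powr:
  fixes p :: real
  assumes "p > 0"
  shows "((\<lambda>t. ((t * (1 - t))^2) powr p) has_integral Beta (2 * p + 1) (2 * p + 1)) {0..1}"
proof (rule has_integral_eq)
  show "((\<lambda>t. t powr (2 * p + 1 - 1) * (1 - t) powr (2 * p + 1 - 1)) has_integral
      Beta (2 * p + 1) (2 * p + 1)) {0..1}"
    using assms by (intro has_integral_Beta_real) auto
next
  fix t :: real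
  assume "t \<in> {0..1}"
  then show "t powr (2 * p + 1 - 1) * (1 - t) powr (2 * p + 1 - 1) = ((t * (1 - t))^2) powr p"
    by (simp add: powr_mult power2_eq_square mult_ac flip: powr_add mult_2)
qed

text \<open>This is Hoelder's inequality on the unit interval with second factor 1. It follows by
  integrating a pointwise Young inequality.\<close>

lemma integral_le_powr_mean:
  fixes g :: "real \<Rightarrow> real" and p I J :: real
  assumes "p > 1" and "I > 0" and "\<And>t. t \<in> {0..1} \<Longrightarrow> g t \<ge> 0"
    and g: "(g has_integral J) {0..1}"
    and gp: "((\<lambda>t. g t powr p) has_integral I) {0..1}"
  shows "J \<le> I powr (1 / p)"
proof -
  \<comment> \<open>Scaling by \<open>c\<close>, the \<open>p\<close>-norm of \<open>g\<close>,
    gives \<open>g / c\<close> norm 1, so that the integrated Young bound is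
    \<open>c * (1 / p + (1 - 1 / p)) = c\<close>.\<close>
  define c where "c = I powr (1 / p)"
  have "c > 0" and cp: "c powr p = I"
    using assms by (auto simp: c_def powr_powr)
  have young: "g t \<le> c / p * (g t powr p / I) + c * (1 - 1 / p)" if "t \<in> {0..1}" for t
  proof -
    have "1 / (p / (p - 1)) = 1 - 1 / p"
      using \<open>p > 1\<close> by (simp add: field_simps)
    then have "g t / c * 1 \<le> (g t / c) powr p / p + 1 powr (p / (p - 1)) / (p / (p - 1))"
      using assms(1) assms(3)[OF that] \<open>c > 0\<close>
      by (intro Youngs_inequality) (auto simp: field_simps)
    then have "g t / c \<le> g t powr p / I / p + (1 - 1 / p)"
      using assms(1) assms(3)[OF that] \<open>c > 0\<close> cp by (simp add: powr_divide field_simps)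
    then have "c * (g t / c) \<le> c * (g t powr p / I / p + (1 - 1 / p))"
      using \<open>c > 0\<close> by (intro mult_left_mono) auto
    then show ?thesis
      using \<open>c > 0\<close> by (simp add: algebra_simps)
  qed
  have "((\<lambda>t. c / p * (g t powr p / I) + c * (1 - 1 / p)) has_integral
      c / p * (I / I) + c * (1 - 1 / p)) {0..1}"
  proof (intro has_integral_add has_integral_mult_right has_integral_divide gp)
    show "((\<lambda>_::real. 1 - 1 / p) has_integral 1 - 1 / p) {0..1}"
      using has_integral_const_real[of "1 - 1 / p" 0 1] by simp
  qed
  then have "J \<le> c / p * (I / I) + c * (1 - 1 / p)"
    using g young by (intro has_integral_le[OF g]) auto
  also have "\<dots> = c"
    using \<open>I > 0\<close> by (simp add: algebra_simps)
  finally show ?thesis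
    by (simp add: c_def)
qed

theorem theorem3p2:
  fixes a b \<alpha> p q :: real
  assumes "0 < a" and "0 < b" and "a < b"
    and "0 < \<alpha>" and "\<alpha> \<le> 1"
    and "1 < p" and "q = p / (p - 1)"
  shows "\<bar>12 * arith_mean (a powr (\<alpha> + 4)) (b powr (\<alpha> + 4))
            - 12 * L_mean (\<alpha> + 4) a b
            - (b - a)^2 * (\<alpha> + 3) * (\<alpha> + 4) * L_mean (\<alpha> + 2) a b\<bar>
         \<le> (b - a)^4 / 2 * (Beta (2 * p + 1) (2 * p + 1)) powr (1 / p)
            * (\<alpha> + 1) * (\<alpha> + 2) * (\<alpha> + 3) * (\<alpha> + 4)
            * (max (\<bar>a powr \<alpha>\<bar> powr q) (\<bar>b powr \<alpha>\<bar> powr q)) powr (1 / q)"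
    (is "\<bar>?E\<bar> \<le> ?R")
proof -
  define B where "B = Beta (2 * p + 1) (2 * p + 1)"
  define C where "C = (\<alpha> + 1) * (\<alpha> + 2) * (\<alpha> + 3) * (\<alpha> + 4) * (b - a)^4"
  define w :: "real \<Rightarrow> real" where "w = (\<lambda>t. (t * (1 - t))^2)"
  define x where "x = (\<lambda>t. a + t * (b - a))"
  have x_bounds: "0 < x t" "x t \<le> b" if "t \<in> {0..1}" for t
  proof -
    show "0 < x t"
      using assms that by (auto simp: x_def intro!: add_pos_nonneg)
    have "t * (b - a) \<le> 1 * (b - a)"
      using assms that by (intro mult_right_mono) auto
    then show "x t \<le> b"
      by (simp add: x_def)
  qed
  \<comment> \<open>Leaving \<open>k'\<close> and \<open>s\<close> as equations lets this one rule
    serve all five derivatives in the chain from \<open>G\<close> to \<open>h4\<close>.\<close>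
  have deriv: "((\<lambda>t. k * x t powr r) has_real_derivative k' * x t powr s) (at t)"
    if "t \<in> {0..1}" "k' = k * r * (b - a)" "s = r - 1" for k k' r s t
    using x_bounds(1)[OF that(1)] that(2,3) unfolding x_def
    by (auto intro!: derivative_eq_intros simp: powr_diff)
  have C_nonneg: "C \<ge> 0"
    using assms by (simp add: C_def)
  have int: "((\<lambda>t. w t * (C * x t powr \<alpha>)) has_integral - 2 * ?E) {0..1}"
  proof -
    \<comment> \<open>The factors \<open>1 *\<close> put \<open>h\<close> into the shape
      \<open>k * x t powr r\<close> of \<open>deriv\<close>. The functions \<open>h2\<close> and
      \<open>h3\<close> are absent from the integral formula, hence given explicitly.\<close>
    have "((\<lambda>t. w t * (C * x t powr \<alpha>)) has_integral
        2 * ((\<alpha> + 4) * (b - a) * x 1 powr (\<alpha> + 3) - (\<alpha> + 4) * (b - a) * x 0 powr (\<alpha> + 3))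
        - 12 * (1 * x 1 powr (\<alpha> + 4) + 1 * x 0 powr (\<alpha> + 4))
        + 24 * (1 / ((\<alpha> + 5) * (b - a)) * x 1 powr (\<alpha> + 5)
              - 1 / ((\<alpha> + 5) * (b - a)) * x 0 powr (\<alpha> + 5))) {0..1}"
      unfolding w_def
      by (rule has_integral_quartic_weight[where
            ?h2.0 = "\<lambda>t. (\<alpha> + 3) * (\<alpha> + 4) * (b - a)^2 * x t powr (\<alpha> + 2)" and
            ?h3.0 = "\<lambda>t. (\<alpha> + 2) * (\<alpha> + 3) * (\<alpha> + 4) * (b - a)^3 * x t powr (\<alpha> + 1)"];
          rule deriv)
         (use assms in \<open>auto simp: C_def power2_eq_square power3_eq_cube power4_eq_xxxx\<close>)
    \<comment> \<open>\<open>L_mean r\<close> involves the exponent \<open>r + 1\<close>: the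
      increment of \<open>h'\<close> thus yields index \<alpha> + 2, and the integral of
      \<open>h\<close> yields index \<alpha> + 4.\<close>
    moreover have "(\<alpha> + 4) * (b - a) * b powr (\<alpha> + 3) - (\<alpha> + 4) * (b - a) * a powr (\<alpha> + 3)
        = (b - a)^2 * (\<alpha> + 3) * (\<alpha> + 4) * L_mean (\<alpha> + 2) a b"
      using assms by (simp add: L_mean_def power2_eq_square add.assoc flip: right_diff_distrib)
    moreover have "1 / ((\<alpha> + 5) * (b - a)) * b powr (\<alpha> + 5) - 1 / ((\<alpha> + 5) * (b - a)) * a powr (\<alpha> + 5)
        = L_mean (\<alpha> + 4) a b"
      by (simp add: L_mean_def add.assoc diff_divide_distrib)
    moreover have "x 0 = a" "x 1 = b"
      by (simp_all add: x_def)
    ultimately show ?thesis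
      by (simp only:) (simp add: arith_mean_def add_divide_distrib algebra_simps)
  qed
  have "w integrable_on {0..1}"
    unfolding w_def by (intro integrable_continuous_interval continuous_intros)
  then obtain J where J: "(w has_integral J) {0..1}"
    by blast
  have wp: "((\<lambda>t. w t powr p) has_integral B) {0..1}"
    using has_integral_quartic_weight_powr[of p] assms by (simp add: w_def B_def)
  have "B > 0"
    using assms by (simp add: B_def Beta_def)
  then have "J \<le> B powr (1 / p)"
    using assms J wp by (intro integral_le_powr_mean[of p B w]) (auto simp: w_def)
  have "- 2 * ?E \<le> J * (C * b powr \<alpha>)"
    using assms C_nonneg
    by (intro has_integral_le[OF int has_integral_mult_left[OF J]] mult_left_mono powr_mono2)
       (auto simp: w_def intro!: x_bounds less_imp_le[OF x_bounds(1)])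
  also have "\<dots> \<le> B powr (1 / p) * (C * b powr \<alpha>)"
    using \<open>J \<le> _\<close> C_nonneg by (intro mult_right_mono) auto
  finally have upper: "- 2 * ?E \<le> B powr (1 / p) * (C * b powr \<alpha>)" .
  \<comment> \<open>The integrand is nonnegative, which fixes the sign of \<open>?E\<close>; the
    upper bound alone then controls its absolute value.\<close>
  have lower: "0 \<le> - 2 * ?E"
    using C_nonneg by (intro has_integral_nonneg[OF int]) (auto simp: w_def)
  \<comment> \<open>The maximum is attained at \<open>b\<close>, and the outer power
    \<open>1 / q\<close> then cancels \<open>q\<close>, leaving
    \<open>b powr \<alpha>\<close>.\<close>
  have "(a powr \<alpha>) powr q \<le> (b powr \<alpha>) powr q"
    using assms by (intro powr_mono2) auto
  then have "max (\<bar>a powr \<alpha>\<bar> powr q) (\<bar>b powr \<alpha>\<bar> powr q) = (b powr \<alpha>) powr q"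
    by simp
  then have "2 * ?R = B powr (1 / p) * (C * b powr \<alpha>)"
    using assms by (simp add: powr_powr B_def C_def)
  moreover have "\<bar>e\<bar> \<le> r" if "- 2 * e \<le> s" "0 \<le> - 2 * e" "2 * r = s" for e r s :: real
    using that by linarith
  ultimately show ?thesis
    using upper lower by blast
qed

end
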